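(* Let $M\ge2$ and $m=1$. For every finite size $N=|\mathcal V|$ there exist a set $\mathcal V$ of $N$ valuation vectors with entries in $[0,1]$, a sequence of contexts from $\mathcal V$, and competing bids $[\boldsymbol\beta_-^t]_{t\in[T]}$ such that, for adversarial contexts and under any learning algorithm, $\mathbb E[\mathsf{REG}_{adv}]=\Omega(M\sqrt{|\mathcal V|T})$ in the full information setting.
   Context: A uniform price auction selling $K$ identical units is repeated over $T$ rounds. For a valuation vector $\mathbf v=(v_1,\dots,v_M)$ with $1\ge v_1\ge\dots\ge v_M\ge0$ let $w_j(\mathbf v)=\frac1j\sum_{\ell\le j}v_\ell$. A $1$-uniform strategy $(b,q)$ bids $b$ for each of $q$ units; $\overline{\mathcal P}_{\le1}(\mathbf v)=\{(w_q(\mathbf v),q):q\in[M]\}$. With competing bids $\boldsymbol\beta_-$, the $K$ highest bids win a unit each (ties in favor of the bidder), $x$ is the bidder's number of winning bids, value with valuation $\mathbf v$ is $\sum_{j\le x}v_j$. Contexts $\mathbf v^t\in\mathcal V$ are chosen adversarially in advance; $\mathbf v^t$ is revealed at the start of round $t$, the learner submits $\mathbf b^t\in\overline{\mathcal P}_{\le1}(\mathbf v^t)$ and then observes $\boldsymbol\beta_-^t$ (full information). $\Pi$ is the set of maps $\pi$ on $\mathcal V$ with $\pi(\mathbf v)\in\overline{\mathcal P}_{\le1}(\mathbf v)$. $\mathsf{REG}_{adv}=\max_{\pi\in\Pi}\sum_tV(\pi(\mathbf v^t);\boldsymbol\beta_-^t)-\sum_t\mathbb E[V(\mathbf b^t;\boldsymbol\beta_-^t)]$;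 $\mathbb E[\mathsf{REG}_{adv}]$ may also average over randomness of the competing bids.
   Formalization: The formal theorem assumes K ≥ M and T ≥ |V|, with one absolute constant; without these the bound fails: for K = 1 always bidding (w_1, 1) has no regret, and for T = 1 the regret is at most M while M√|V| is unbounded. *)

theory Defs
  imports "HOL-Probability.Probability"
begin

type_synonym valuation = "real list"
type_synonym bid = "real \<times> nat"
type_synonym competing = "real list"
type_synonym history = "(valuation \<times> bid \<times> competing) list"

definition valuations :: "nat \<Rightarrow> valuation set" where
  "valuations M = {v. length v = M \<and> set v \<subseteq> {0..1} \<and> sorted_wrt (\<ge>) v}"

definition avg_val :: "valuation \<Rightarrow> nat \<Rightarrow> real" where
  "avg_val v j = sum_list (take j v) / real j"

text \<open>A pair \<open>(b, q)\<close> is the 1-uniform strategy bidding \<open>b\<close> for each of \<open>q\<close> units.\<close>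

definition safe_strategies :: "nat \<Rightarrow> valuation \<Rightarrow> bid set" where
  "safe_strategies M v = (\<lambda>q. (avg_val v q, q)) ` {1..M}"

definition competing_bids :: "nat \<Rightarrow> competing set" where
  "competing_bids K = {\<beta>. length \<beta> = K \<and> set \<beta> \<subseteq> {0..1}}"

text \<open>Bids are tagged with whether they are the bidder's own. The sort is stable, so listing the
  bidder's own bids first breaks ties in the bidder's favour.\<close>

definition units_won :: "nat \<Rightarrow> real list \<Rightarrow> competing \<Rightarrow> nat" where
  "units_won K own \<beta> =
     length (filter snd (take K (sort_key (\<lambda>p. - fst p)
       (map (\<lambda>b. (b, True)) own @ map (\<lambda>b. (b, False)) \<beta>))))"

definition auction_value :: "nat \<Rightarrow> valuation \<Rightarrow> bid \<Rightarrow> competing \<Rightarrow> real" where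
  "auction_value K v s \<beta> = sum_list (take (units_won K (replicate (snd s) (fst s)) \<beta>) v)"

text \<open>A (randomized) algorithm maps the observed history and the current context to a distribution
  over bids. The history includes the learner's own past bids, so this covers algorithms whose
  randomization is correlated across rounds.\<close>

type_synonym algorithm = "history \<Rightarrow> valuation \<Rightarrow> bid pmf"

definition learning_algorithm :: "nat \<Rightarrow> valuation set \<Rightarrow> algorithm \<Rightarrow> bool" where
  "learning_algorithm M V A \<longleftrightarrow> (\<forall>h. \<forall>v\<in>V. set_pmf (A h v) \<subseteq> safe_strategies M v)"

text \<open>Rounds are numbered from 0; \<open>history_pmf A v \<beta> t\<close> is the law of the history observed before
  round \<open>t\<close>.\<close>

primrec history_pmf ::
  "algorithm \<Rightarrow> (nat \<Rightarrow> valuation) \<Rightarrow> (nat \<Rightarrow> competing) \<Rightarrow> nat \<Rightarrow> history pmf" where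
  "history_pmf A v \<beta> 0 = return_pmf []"
| "history_pmf A v \<beta> (Suc t) =
     bind_pmf (history_pmf A v \<beta> t) (\<lambda>h.
       map_pmf (\<lambda>b. h @ [(v t, b, \<beta> t)]) (A h (v t)))"

definition bid_pmf ::
  "algorithm \<Rightarrow> (nat \<Rightarrow> valuation) \<Rightarrow> (nat \<Rightarrow> competing) \<Rightarrow> nat \<Rightarrow> bid pmf" where
  "bid_pmf A v \<beta> t = bind_pmf (history_pmf A v \<beta> t) (\<lambda>h. A h (v t))"

definition policies :: "nat \<Rightarrow> valuation set \<Rightarrow> (valuation \<Rightarrow> bid) set" where
  "policies M V = (\<Pi>\<^sub>E v\<in>V. safe_strategies M v)"

definition regret_adv ::
  "nat \<Rightarrow> nat \<Rightarrow> nat \<Rightarrow> valuation set \<Rightarrow> (nat \<Rightarrow> valuation) \<Rightarrow> algorithm \<Rightarrow> (nat \<Rightarrow> competing) \<Rightarrow> real" where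
  "regret_adv M K T V v A \<beta> =
     Max ((\<lambda>\<pi>. \<Sum>t<T. auction_value K (v t) (\<pi> (v t)) (\<beta> t)) ` policies M V)
     - (\<Sum>t<T. measure_pmf.expectation (bid_pmf A v \<beta> t)
                 (\<lambda>b. auction_value K (v t) b (\<beta> t)))"

end

theory Submission
  imports Defs
begin

text \<open>Take valuations with \<open>h = M div 2\<close> entries \<open>s\<close> followed by a smaller constant, for \<open>N\<close> different
  scales \<open>s\<close>. In every round an independent coin sets all competing bids to \<open>0\<close> (probability \<open>2/3\<close>) or
  to \<open>s\<close>. Bidding for \<open>h\<close> units wins them in both cases, bidding for \<open>M\<close> units wins only in the first
  case; the constant is such that both have mean value \<open>s h\<close> and no safe bid has more, so a learner gains
  at most \<open>s h\<close> per round. In hindsight the better of the two bids gains on top \<open>s h / 2\<close> times the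
  positive part of a centered random walk over the rounds of that context, which has mean of order
  \<open>sqrt (T / N)\<close> by a second and fourth moment estimate; summing over the contexts gives the bound.\<close>

section \<open>Outcome of the auction against equal competing bids\<close>

lemma insort_key_append_replicate:
  assumes "f a < f x"
  shows "insort_key f x (replicate K a @ replicate q x) = replicate K a @ replicate (Suc q) x"
  using assms by (induction K) (auto simp: insort_is_Cons)

text \<open>For the losing case: the own bids \<open>x\<close> stand first in the list, but strictly
  higher competing bids \<open>a\<close> overtake them, the keys being negated bids. In the winning
  case the list is sorted already.\<close>

lemma sort_key_replicate_swap:
  assumes "f a < f x"
  shows "sort_key f (replicate q x @ replicate K a) = replicate K a @ replicate q x"
proof (induction q)
  case 0
  show ?case by (simp add: sort_key_id_if_sorted)
next
  case (Suc q)
  then show ?case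
    using insort_key_append_replicate[of f a x K q] assms by simp
qed

lemma units_won_uniform_price:
  assumes "q \<le> K"
  shows "units_won K (replicate q b) (replicate K p) = (if p \<le> b then q else 0)"
proof (cases "p \<le> b")
  case True
  have "sort_key (\<lambda>p. - fst p) (replicate q (b, True) @ replicate K (p, False))
      = replicate q (b, True) @ replicate K (p, False)"
    using True by (intro sort_key_id_if_sorted) (auto simp: sorted_append)
  with True assms show ?thesis by (simp add: units_won_def)
next
  case False
  have "sort_key (\<lambda>p. - fst p) (replicate q (b, True) @ replicate K (p, False))
      = replicate K (p, False) @ replicate q (b, True)"
    using False by (intro sort_key_replicate_swap) auto
  with False show ?thesis by (simp add: units_won_def)
qed

lemma auction_value_uniform_price:
  assumes "q \<le> K"
  shows "auction_value K v (b, q) (replicate K p) = (if p \<le> b then sum_list (take q v) else 0)"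
  using assms by (simp add: auction_value_def units_won_uniform_price)

section \<open>Two-step valuations and the mean value of safe bids\<close>

definition tail_ratio :: "nat \<Rightarrow> real" where
  "tail_ratio M = real (M div 2) / (2 * real (M - M div 2))"

text \<open>The factor \<open>tail_ratio M\<close> makes the tail add up to half the head sum s h,
  so all \<open>M\<close> units are worth 3/2 s h and, won with probability 2/3, have mean s
  h.\<close>

definition two_step_valuation :: "nat \<Rightarrow> real \<Rightarrow> valuation" where
  "two_step_valuation M s = replicate (M div 2) s @ replicate (M - M div 2) (s * tail_ratio M)"

lemma tail_ratio_bounds:
  assumes "M \<ge> 2"
  shows "tail_ratio M \<ge> 0" "tail_ratio M \<le> 1 / 2"
  using assms by (auto simp: tail_ratio_def field_simps)

lemma two_step_valuation_in_valuations:
  assumes "M \<ge> 2" "0 \<le> s" "s \<le> 1"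
  shows "two_step_valuation M s \<in> valuations M"
  using assms tail_ratio_bounds[of M] mult_left_le[of "tail_ratio M" s]
  by (auto simp: valuations_def two_step_valuation_def sorted_wrt_append set_replicate_conv_if
        sorted_wrt_iff_nth_less[of _ "replicate _ _"])

lemma hd_two_step_valuation: "M \<ge> 2 \<Longrightarrow> hd (two_step_valuation M s) = s"
  by (cases "M div 2") (auto simp: two_step_valuation_def)

lemma sum_take_two_step:
  assumes "q \<le> M"
  shows "sum_list (take q (two_step_valuation M s)) =
    (if q \<le> M div 2 then real q * s
     else real (M div 2) * s + real (q - M div 2) * (s * tail_ratio M))"
  using assms by (auto simp: two_step_valuation_def sum_list_replicate min_def)

lemma sum_take_two_step_full:
  assumes "M \<ge> 2"
  shows "sum_list (take M (two_step_valuation M s)) = 3 / 2 * real (M div 2) * s"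
proof -
  have "\<not> M \<le> M div 2" using assms by linarith
  then have "sum_list (take M (two_step_valuation M s)) =
      real (M div 2) * s + real (M - M div 2) * (s * tail_ratio M)"
    by (simp add: sum_take_two_step)
  moreover have "real (M - M div 2) * tail_ratio M = real (M div 2) / 2"
  proof -
    have "real (M - M div 2) \<noteq> 0" using assms by simp
    then show ?thesis unfolding tail_ratio_def by (simp del: of_nat_diff)
  qed
  ultimately show ?thesis by algebra
qed

lemma avg_val_two_step_head:
  assumes "1 \<le> q" "q \<le> M div 2"
  shows "avg_val (two_step_valuation M s) q = s"
  using assms by (auto simp: avg_val_def sum_take_two_step)

text \<open>Every tail entry is below \<open>s\<close> and pulls the average down. Strictness
  matters: ties favour the bidder, so only a bid strictly below the price \<open>s\<close>
  loses.\<close>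

lemma avg_val_two_step_tail:
  assumes "M \<ge> 2" "0 < s" "M div 2 < q" "q \<le> M"
  shows "avg_val (two_step_valuation M s) q < s"
proof -
  have "real (q - M div 2) * (s * tail_ratio M) < real (q - M div 2) * s"
    using assms tail_ratio_bounds[OF assms(1)] by simp
  then have "sum_list (take q (two_step_valuation M s)) < real q * s"
    using assms by (simp add: sum_take_two_step algebra_simps)
  then show ?thesis using assms by (simp add: avg_val_def field_simps)
qed

lemma avg_val_two_step_nonneg:
  assumes "M \<ge> 2" "0 \<le> s" "q \<le> M"
  shows "0 \<le> avg_val (two_step_valuation M s) q"
  using assms tail_ratio_bounds[OF assms(1)] by (simp add: avg_val_def sum_take_two_step)

text \<open>Equal competing bids let the bidder win all units demanded or none. For a two-step
  valuation \<open>hd v\<close> is the scale, which is exactly the safe bid for up to h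
  units.\<close>

definition coin_bids :: "nat \<Rightarrow> valuation \<Rightarrow> bool \<Rightarrow> competing" where
  "coin_bids K v x = replicate K (if x then 0 else hd v)"

lemma value_two_step:
  assumes "M \<ge> 2" "M \<le> K" "0 < s" "1 \<le> q" "q \<le> M"
  defines "v \<equiv> two_step_valuation M s"
  shows "auction_value K v (avg_val v q, q) (coin_bids K v x) =
    (if x \<or> q \<le> M div 2 then sum_list (take q v) else 0)"
  using assms avg_val_two_step_head[of q M s] avg_val_two_step_tail[of M s q]
    avg_val_two_step_nonneg[of M s q]
  by (auto simp: coin_bids_def auction_value_uniform_price hd_two_step_valuation)

text \<open>Up to h units a safe bid always wins and is worth at most s h. Beyond h it is worth at
  most 3/2 s h, but wins only with probability 2/3. Both bounds are attained, at q = h and q =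
  M.\<close>

lemma mean_value_two_step_le:
  assumes "M \<ge> 2" "M \<le> K" "0 < s" and b: "b \<in> safe_strategies M (two_step_valuation M s)"
  defines "v \<equiv> two_step_valuation M s"
  shows "2 / 3 * auction_value K v b (coin_bids K v True)
       + 1 / 3 * auction_value K v b (coin_bids K v False) \<le> s * real (M div 2)"
proof -
  from b obtain q where q: "1 \<le> q" "q \<le> M" "b = (avg_val v q, q)"
    by (auto simp: safe_strategies_def v_def)
  show ?thesis
  proof (cases "q \<le> M div 2")
    case True
    have "real q * s \<le> real (M div 2) * s"
      using True assms(3) by (intro mult_right_mono) auto
    with True show ?thesis
      using value_two_step[OF assms(1-3) q(1,2)] q(2)
      by (simp add: q(3) v_def sum_take_two_step algebra_simps)
  next
    case False
    have "real (q - M div 2) * (s * tail_ratio M) \<le> real (M - M div 2) * (s * tail_ratio M)"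
      using q assms(3) tail_ratio_bounds[OF assms(1)] by (intro mult_right_mono) auto
    then have "sum_list (take q v) \<le> sum_list (take M v)"
      using False q assms(1) by (auto simp: v_def sum_take_two_step)
    also have "\<dots> = 3 / 2 * real (M div 2) * s"
      unfolding v_def by (rule sum_take_two_step_full[OF assms(1)])
    finally show ?thesis
      using value_two_step[OF assms(1-3) q(1,2)] False by (simp add: q(3) v_def mult.commute)
  qed
qed

section \<open>Independent coins and the moments of the random walk\<close>

definition coins :: "nat \<Rightarrow> (nat \<Rightarrow> bool) pmf" where
  "coins T = Pi_pmf {..<T} False (\<lambda>_. bernoulli_pmf (2 / 3))"

abbreviation coin_mean :: "nat \<Rightarrow> ((nat \<Rightarrow> bool) \<Rightarrow> real) \<Rightarrow> real" where
  "coin_mean T g \<equiv> measure_pmf.expectation (coins T) g"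

text \<open>The default \<open>False\<close> outside \<open>{..<T}\<close> leaves finitely many coin
  sequences, which makes every real function of them integrable.\<close>

lemma finite_set_pmf_coins: "finite (set_pmf (coins T))"
  unfolding coins_def
  by (rule finite_subset[OF set_Pi_pmf_subset']) auto

lemma integrable_coins [simp]: "integrable (measure_pmf (coins T)) (g :: _ \<Rightarrow> real)"
  by (rule integrable_measure_pmf_finite[OF finite_set_pmf_coins])

text \<open>Redrawing coin \<open>t\<close> preserves the product law. Independence enters the
  moments of the walk and the bound on the learner only in this form.\<close>

lemma coin_mean_resample:
  assumes "t < T"
  shows "coin_mean T g = coin_mean T (\<lambda>x. 2 / 3 * g (x(t := True)) + 1 / 3 * g (x(t := False)))"
proof -
  define R where "R = Pi_pmf ({..<T} - {t}) False (\<lambda>_. bernoulli_pmf (2 / 3))"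
  have finR: "finite (set_pmf R)"
    unfolding R_def
    by (rule finite_subset[OF set_Pi_pmf_subset']) auto
  have "{..<T} = insert t ({..<T} - {t})" using assms by auto
  then have "coins T = Pi_pmf (insert t ({..<T} - {t})) False (\<lambda>_. bernoulli_pmf (2 / 3))"
    by (simp add: coins_def)
  also have "\<dots> = map_pmf (\<lambda>(y, f). f(t := y)) (pair_pmf (bernoulli_pmf (2 / 3)) R)"
    unfolding R_def by (rule Pi_pmf_insert) auto
  also have "\<dots> = map_pmf (\<lambda>(f, y). f(t := y)) (pair_pmf R (bernoulli_pmf (2 / 3)))"
    by (subst pair_commute_pmf) (simp add: map_pmf_comp case_prod_unfold)
  also have "\<dots> = bind_pmf R (\<lambda>f. map_pmf (\<lambda>y. f(t := y)) (bernoulli_pmf (2 / 3)))"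
    by (simp add: pair_pmf_def map_bind_pmf map_pmf_def bind_assoc_pmf bind_return_pmf)
  finally have c: "coins T = bind_pmf R (\<lambda>f. map_pmf (\<lambda>y. f(t := y)) (bernoulli_pmf (2 / 3)))" .
  have *: "coin_mean T h =
      measure_pmf.expectation R (\<lambda>x. 2 / 3 * h (x(t := True)) + 1 / 3 * h (x(t := False)))"
    for h :: "(nat \<Rightarrow> bool) \<Rightarrow> real"
    unfolding c using finR
    by (subst pmf_expectation_bind[of "set_pmf R"])
       (auto simp: integral_measure_pmf[of "set_pmf R"] algebra_simps intro!: sum.cong)
  \<comment> \<open>Expand both sides by \<open>*\<close>. The resampled function no longer depends
    on coordinate \<open>t\<close>, and 2/3 + 1/3 = 1, so expanding it changes nothing.\<close>
  show ?thesis
    unfolding *[of g] *[of "\<lambda>x. 2 / 3 * g (x(t := True)) + 1 / 3 * g (x(t := False))"]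
    by (intro Bochner_Integration.integral_cong) (simp_all add: field_simps)
qed

text \<open>In units of s h / 2, this is the gain of bidding for \<open>M\<close> instead of h
  units: 3/2 s h - s h at price 0, and 0 - s h at price \<open>s\<close>. It has mean 2/3 - 2/3 =
  0.\<close>

definition step :: "bool \<Rightarrow> real" where
  "step x = (if x then 1 else - 2)"

definition walk :: "nat set \<Rightarrow> (nat \<Rightarrow> bool) \<Rightarrow> real" where
  "walk I x = (\<Sum>t\<in>I. step (x t))"

lemma coin_mean_walk_insert:
  assumes "finite I" "t \<notin> I" "t < T"
  shows "coin_mean T (\<lambda>x. f (walk (insert t I) x)) =
    coin_mean T (\<lambda>x. 2 / 3 * f (walk I x + 1) + 1 / 3 * f (walk I x - 2))"
proof -
  have "walk (insert t I) (x(t := b)) = walk I x + step b" for x b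
  proof -
    have "walk I (x(t := b)) = walk I x"
      unfolding walk_def using assms by (intro sum.cong) auto
    then show ?thesis using assms by (simp add: walk_def)
  qed
  then show ?thesis
    by (subst coin_mean_resample[OF assms(3)]) (simp add: step_def)
qed

text \<open>Induction over the steps, whose first four moments are 0, 2, -2 and 6. The three claims
  go together because the fourth moment recursion involves the lower ones.\<close>

lemma walk_moments:
  assumes "finite I" "I \<subseteq> {..<T}"
  shows "coin_mean T (walk I) = 0"
    and "coin_mean T (\<lambda>x. walk I x ^ 2) = 2 * real (card I)"
    and "coin_mean T (\<lambda>x. walk I x ^ 4) \<le> 12 * real (card I) ^ 2"
proof -
  have "coin_mean T (walk I) = 0 \<and> coin_mean T (\<lambda>x. walk I x ^ 2) = 2 * real (card I)
    \<and> coin_mean T (\<lambda>x. walk I x ^ 4) \<le> 12 * real (card I) ^ 2"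
    using assms
  proof (induction I rule: finite_induct)
    case empty
    then show ?case by (simp add: walk_def)
  next
    case (insert t I)
    then have t: "t < T" and I: "coin_mean T (walk I) = 0"
      "coin_mean T (\<lambda>x. walk I x ^ 2) = 2 * real (card I)"
      "coin_mean T (\<lambda>x. walk I x ^ 4) \<le> 12 * real (card I) ^ 2"
      by auto
    note * = coin_mean_walk_insert[OF insert(1,2) t]
    have 1: "coin_mean T (walk (insert t I)) = 0"
    proof -
      have eq: "2 / 3 * (w + 1) + 1 / 3 * (w - 2) = w" for w :: real by (simp add: field_simps)
      have "coin_mean T (\<lambda>x. walk (insert t I) x) =
          coin_mean T (walk I)"
        by (simp only: eq *[of "\<lambda>w. w"])
      with I show ?thesis by simp
    qed
    have 2: "coin_mean T (\<lambda>x. walk (insert t I) x ^ 2) = 2 * real (card I) + 2"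
    proof -
      have eq: "2 / 3 * (w + 1) ^ 2 + 1 / 3 * (w - 2) ^ 2 = w ^ 2 + 2" for w :: real
        by algebra
      have "coin_mean T (\<lambda>x. walk (insert t I) x ^ 2) =
          coin_mean T (\<lambda>x. walk I x ^ 2 + 2)"
        by (simp only: eq *[of "\<lambda>w. w ^ 2"])
      with I show ?thesis by simp
    qed
    have 3: "coin_mean T (\<lambda>x. walk (insert t I) x ^ 4) \<le>
        12 * real (card I) ^ 2 + 24 * real (card I) + 6"
    proof -
      have eq: "2 / 3 * (w + 1) ^ 4 + 1 / 3 * (w - 2) ^ 4 = w ^ 4 + 12 * w ^ 2 - 8 * w + 6"
        for w :: real
        by algebra
      have "coin_mean T (\<lambda>x. walk (insert t I) x ^ 4) =
          coin_mean T (\<lambda>x. walk I x ^ 4 + 12 * walk I x ^ 2 - 8 * walk I x + 6)"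
        by (simp only: eq *[of "\<lambda>w. w ^ 4"])
      with I show ?thesis by simp
    qed
    \<comment> \<open>The fourth moment closes because 12 n^2 + 24 n + 6 <= 12 (n + 1)^2.\<close>
    show ?case
      using 1 2 3 insert(1,2) by (simp add: power2_eq_square algebra_simps)
  qed
  then show "coin_mean T (walk I) = 0"
    and "coin_mean T (\<lambda>x. walk I x ^ 2) = 2 * real (card I)"
    and "coin_mean T (\<lambda>x. walk I x ^ 4) \<le> 12 * real (card I) ^ 2"
    by auto
qed

lemma abs_ge_quartic:
  fixes w s :: real
  assumes "s > 0"
  shows "(3 * s ^ 2 * w ^ 2 - w ^ 4) / (2 * s ^ 3) \<le> \<bar>w\<bar>"
proof -
  \<comment> \<open>With \<open>y = \<bar>w\<bar> / s\<close> this is \<open>y ^ 3 - 3 * y + 2 = (y - 1) ^ 2 * (y + 2)\<close>.\<close>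
  have "0 \<le> \<bar>w\<bar> * ((\<bar>w\<bar> - s) ^ 2 * (\<bar>w\<bar> + 2 * s))"
    using assms by simp
  also have "\<dots> = \<bar>w\<bar> ^ 4 - 3 * s ^ 2 * \<bar>w\<bar> ^ 2 + 2 * s ^ 3 * \<bar>w\<bar>"
    by (simp add: power4_eq_xxxx power2_eq_square power3_eq_cube algebra_simps)
  also have "\<bar>w\<bar> ^ 4 = w ^ 4" by simp
  finally show ?thesis using assms by (simp add: divide_le_eq algebra_simps)
qed

text \<open>The positive part of w is (w + \<bar>w\<bar>) / 2, and \<open>abs_ge_quartic\<close>
  bounds \<bar>w\<bar> from below by a polynomial whose mean is controlled by the moments.\<close>

lemma walk_pos_part:
  assumes "finite I" "I \<subseteq> {..<T}"
  shows "3 / 8 * sqrt (real (card I)) \<le> coin_mean T (\<lambda>x. max 0 (walk I x))"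
proof (cases "card I = 0")
  case True
  then show ?thesis by simp
next
  case False
  define r where "r = sqrt (real (card I))"
  \<comment> \<open>Any positive multiple of \<open>r\<close> is admissible in
    \<open>abs_ge_quartic\<close>; 2 is close to the optimal factor \<open>sqrt 6\<close> and gives
    the constant 3/8.\<close>
  define s where "s = 2 * r"
  have r: "r > 0" "real (card I) = r ^ 2" using False by (auto simp: r_def)
  have s: "s > 0" using r by (simp add: s_def)
  note m = walk_moments[OF assms]
  let ?g = "\<lambda>x. (walk I x + (3 * s ^ 2 * walk I x ^ 2 - walk I x ^ 4) / (2 * s ^ 3)) / 2"
  have "coin_mean T ?g =
      (coin_mean T (walk I) + (3 * s ^ 2 * coin_mean T (\<lambda>x. walk I x ^ 2)
        - coin_mean T (\<lambda>x. walk I x ^ 4)) / (2 * s ^ 3)) / 2"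
    by simp
  also have "\<dots> \<ge> ((3 * s ^ 2 * (2 * r ^ 2) - 12 * (r ^ 2) ^ 2) / (2 * s ^ 3)) / 2"
    using m s by (simp add: r(2)[symmetric] divide_right_mono)
  also have "((3 * s ^ 2 * (2 * r ^ 2) - 12 * (r ^ 2) ^ 2) / (2 * s ^ 3)) / 2 = 3 / 8 * r"
    using r(1) by (simp add: s_def power2_eq_square power3_eq_cube field_simps)
  finally have "3 / 8 * r \<le> coin_mean T ?g" .
  also have "\<dots> \<le> coin_mean T (\<lambda>x. max 0 (walk I x))"
  proof (intro integral_mono integrable_coins)
    fix x
    show "?g x \<le> max 0 (walk I x)"
      using abs_ge_quartic[OF s, of "walk I x"] by (cases "0 \<le> walk I x") auto
  qed
  finally show ?thesis by (simp add: r_def)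
qed

section \<open>Upper bound on the learner's mean value\<close>

lemma history_pmf_cong:
  assumes "\<And>i. i < t \<Longrightarrow> \<beta> i = \<beta>' i"
  shows "history_pmf A v \<beta> t = history_pmf A v \<beta>' t"
  using assms by (induction t) auto

lemma bid_pmf_cong:
  assumes "\<And>i. i < t \<Longrightarrow> \<beta> i = \<beta>' i"
  shows "bid_pmf A v \<beta> t = bid_pmf A v \<beta>' t"
  using history_pmf_cong[of t \<beta> \<beta>' A v] assms by (simp add: bid_pmf_def)

lemma set_bid_pmf_subset:
  assumes "learning_algorithm M V A" "v t \<in> V"
  shows "set_pmf (bid_pmf A v \<beta> t) \<subseteq> safe_strategies M (v t)"
  using assms by (auto simp: bid_pmf_def learning_algorithm_def)

lemma finite_safe_strategies: "finite (safe_strategies M v)"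
  by (simp add: safe_strategies_def)

text \<open>The bid in round \<open>t\<close> depends only on coins of earlier rounds. Resampling
  coin \<open>t\<close> therefore leaves its law fixed and averages the value of each bid over the
  coin, where \<open>mean_value_two_step_le\<close> applies.\<close>

lemma learner_mean_value_le:
  assumes A: "learning_algorithm M V A" and V: "v t \<in> V" and t: "t < T"
    and vt: "v t = two_step_valuation M s" and M: "M \<ge> 2" "M \<le> K" and s: "0 < s"
  shows "coin_mean T (\<lambda>x. measure_pmf.expectation (bid_pmf A v (\<lambda>i. coin_bids K (v i) (x i)) t)
      (\<lambda>b. auction_value K (v t) b (coin_bids K (v t) (x t)))) \<le> s * real (M div 2)"
proof -
  let ?P = "\<lambda>x. bid_pmf A v (\<lambda>i. coin_bids K (v i) (x i)) t"
  let ?u = "\<lambda>c b. auction_value K (v t) b (coin_bids K (v t) c)"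
  have P: "?P (x(t := c)) = ?P x" for x c
    by (rule bid_pmf_cong) auto
  have sub: "set_pmf (?P x) \<subseteq> safe_strategies M (v t)" for x
    by (rule set_bid_pmf_subset[where v = v, OF A V])
  have int: "integrable (measure_pmf (?P x)) g" for x and g :: "bid \<Rightarrow> real"
    by (rule integrable_measure_pmf_finite[OF finite_subset[OF sub finite_safe_strategies]])
  have "coin_mean T (\<lambda>x. measure_pmf.expectation (?P x) (?u (x t))) =
      coin_mean T (\<lambda>x. 2 / 3 * measure_pmf.expectation (?P x) (?u True)
        + 1 / 3 * measure_pmf.expectation (?P x) (?u False))"
    by (subst coin_mean_resample[OF t]) (simp only: P fun_upd_same)
  also have "\<dots> = coin_mean T (\<lambda>x. measure_pmf.expectation (?P x)
      (\<lambda>b. 2 / 3 * ?u True b + 1 / 3 * ?u False b))"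
    by (simp add: int)
  also have "\<dots> \<le> s * real (M div 2)"
  proof (rule measure_pmf.integral_le_const[OF integrable_coins], rule AE_I2)
    fix x
    show "measure_pmf.expectation (?P x) (\<lambda>b. 2 / 3 * ?u True b + 1 / 3 * ?u False b)
        \<le> s * real (M div 2)"
    proof (rule measure_pmf.integral_le_const[OF int])
      show "AE b in measure_pmf (?P x). 2 / 3 * ?u True b + 1 / 3 * ?u False b \<le> s * real (M div 2)"
        using sub[of x] mean_value_two_step_le[OF M s] by (auto simp: AE_measure_pmf_iff vt)
    qed
  qed
  finally show ?thesis .
qed

section \<open>The policy chosen in hindsight and the expected regret\<close>

lemma policy_value_ge:
  assumes M: "M \<ge> 2" "M \<le> K" and V: "finite V" "\<And>t. t < T \<Longrightarrow> v t \<in> V"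
    and step: "\<And>u. u \<in> V \<Longrightarrow> 0 < hd u \<and> u = two_step_valuation M (hd u)"
  shows "(\<Sum>t<T. hd (v t) * real (M div 2))
      + (\<Sum>u\<in>V. hd u * real (M div 2) / 2 * max 0 (walk {t. t < T \<and> v t = u} x))
    \<le> Max ((\<lambda>\<pi>. \<Sum>t<T. auction_value K (v t) (\<pi> (v t)) (coin_bids K (v t) (x t))) ` policies M V)"
    (is "?L \<le> Max (?F ` _)")
proof -
  let ?I = "\<lambda>u. {t. t < T \<and> v t = u}"
  define h where "h = real (M div 2)"
  \<comment> \<open>In each context, bid for all \<open>M\<close> units if the walk over its rounds
    ended nonnegative and for h units otherwise. The gain over s h per round is then s h / 2 times
    the positive part of the walk.\<close>
  define q where "q = (\<lambda>u. if 0 \<le> walk (?I u) x then M else M div 2)"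
  define \<pi> where "\<pi> = (\<lambda>u\<in>V. (avg_val u (q u), q u))"
  have q: "1 \<le> q u" "q u \<le> M" for u using M by (auto simp: q_def)
  have pol: "\<pi> \<in> policies M V"
    using q by (auto simp: \<pi>_def policies_def safe_strategies_def)
  have group: "(\<Sum>t<T. g t) = (\<Sum>u\<in>V. \<Sum>t\<in>?I u. g t)" for g :: "nat \<Rightarrow> real"
    using sum.group[of "{..<T}" V v g] V by (simp add: image_subset_iff)
  have one: "auction_value K u (\<pi> u) (coin_bids K u b) =
      hd u * h + hd u * h / 2 * (if 0 \<le> walk (?I u) x then step b else 0)" if u: "u \<in> V" for u b
  proof -
    define s where "s = hd u"
    have s: "0 < s" "u = two_step_valuation M s" using step[OF u] by (auto simp: s_def)
    have "\<pi> u = (avg_val u (q u), q u)" using u by (simp add: \<pi>_def)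
    moreover have "\<not> M \<le> M div 2" using M by linarith
    ultimately show ?thesis
      using value_two_step[OF M s(1) q(1) q(2), of u b] sum_take_two_step_full[OF M(1), of s]
        sum_take_two_step[of "M div 2" M s]
      by (auto simp: s(2)[symmetric] s_def[symmetric] q_def h_def step_def algebra_simps)
  qed
  have "?F \<pi> = (\<Sum>u\<in>V. \<Sum>t\<in>?I u. auction_value K u (\<pi> u) (coin_bids K u (x t)))"
    unfolding group by (intro sum.cong) auto
  also have "\<dots> = (\<Sum>u\<in>V. (\<Sum>t\<in>?I u. hd u * h) + hd u * h / 2 * max 0 (walk (?I u) x))"
  proof (rule sum.cong[OF refl])
    fix u assume u: "u \<in> V"
    show "(\<Sum>t\<in>?I u. auction_value K u (\<pi> u) (coin_bids K u (x t)))
        = (\<Sum>t\<in>?I u. hd u * h) + hd u * h / 2 * max 0 (walk (?I u) x)"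
    proof (cases "0 \<le> walk (?I u) x")
      case True
      have "(\<Sum>t\<in>?I u. hd u * h + hd u * h / 2 * step (x t))
          = (\<Sum>t\<in>?I u. hd u * h) + hd u * h / 2 * walk (?I u) x"
        by (simp only: sum.distrib walk_def sum_distrib_left)
      then show ?thesis using True by (simp only: one[OF u] if_True max_absorb2)
    next
      case False
      then show ?thesis by (simp add: one[OF u])
    qed
  qed
  also have "\<dots> = ?L"
    unfolding sum.distrib group h_def by (intro arg_cong2[of _ _ _ _ "(+)"] sum.cong) auto
  finally have "?L = ?F \<pi>" by simp
  moreover have "finite (policies M V)"
    using V(1) by (auto simp: policies_def finite_safe_strategies intro!: finite_PiE)
  ultimately show ?thesis using pol by simp
qed

text \<open>The baseline s h per round in the policy's value covers all that the learner can collect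
  on average, so the mean positive parts of the walks remain.\<close>

lemma expected_regret_ge:
  assumes M: "M \<ge> 2" "M \<le> K" and V: "finite V" "\<And>t. t < T \<Longrightarrow> v t \<in> V"
    and step: "\<And>u. u \<in> V \<Longrightarrow> 0 < hd u \<and> u = two_step_valuation M (hd u)"
    and A: "learning_algorithm M V A"
  shows "(\<Sum>u\<in>V. hd u * real (M div 2) / 2 * (3 / 8 * sqrt (real (card {t. t < T \<and> v t = u}))))
    \<le> coin_mean T (\<lambda>x. regret_adv M K T V v A (\<lambda>t. coin_bids K (v t) (x t)))"
proof -
  let ?I = "\<lambda>u. {t. t < T \<and> v t = u}"
  let ?h = "real (M div 2)"
  let ?L = "\<lambda>t x. measure_pmf.expectation (bid_pmf A v (\<lambda>i. coin_bids K (v i) (x i)) t)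
      (\<lambda>b. auction_value K (v t) b (coin_bids K (v t) (x t)))"
  let ?G = "\<lambda>x. (\<Sum>t<T. hd (v t) * ?h) + (\<Sum>u\<in>V. hd u * ?h / 2 * max 0 (walk (?I u) x))
      - (\<Sum>t<T. ?L t x)"
  have L: "coin_mean T (?L t) \<le> hd (v t) * ?h" if "t < T" for t
    using step[OF V(2)[OF that]] learner_mean_value_le[where v = v, OF A V(2)[OF that] that _ M]
    by blast
  have "(\<Sum>u\<in>V. hd u * ?h / 2 * (3 / 8 * sqrt (real (card (?I u)))))
      \<le> (\<Sum>u\<in>V. hd u * ?h / 2 * coin_mean T (\<lambda>x. max 0 (walk (?I u) x)))"
  proof (rule sum_mono, rule mult_left_mono)
    fix u assume "u \<in> V"
    then show "0 \<le> hd u * ?h / 2" using step[of u] by simp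
    show "3 / 8 * sqrt (real (card (?I u))) \<le> coin_mean T (\<lambda>x. max 0 (walk (?I u) x))"
      by (rule walk_pos_part) auto
  qed
  also have "\<dots> \<le> (\<Sum>t<T. hd (v t) * ?h)
      + (\<Sum>u\<in>V. hd u * ?h / 2 * coin_mean T (\<lambda>x. max 0 (walk (?I u) x)))
      - (\<Sum>t<T. coin_mean T (?L t))"
    using sum_mono[of "{..<T}" "\<lambda>t. coin_mean T (?L t)" "\<lambda>t. hd (v t) * ?h"] L by auto
  also have "\<dots> = coin_mean T ?G"
    by simp
  also have "\<dots> \<le> coin_mean T (\<lambda>x. regret_adv M K T V v A (\<lambda>t. coin_bids K (v t) (x t)))"
  proof (intro integral_mono integrable_coins)
    fix x
    show "?G x \<le> regret_adv M K T V v A (\<lambda>t. coin_bids K (v t) (x t))"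
      unfolding regret_adv_def using policy_value_ge[where v = v and T = T and x = x, OF M V step]
      by (intro diff_right_mono) blast
  qed
  finally show ?thesis .
qed

section \<open>Balanced contexts, distinct scales and the final constant\<close>

lemma card_residue_class_ge:
  fixes N T i :: nat
  assumes "i < N" "N \<le> T"
  shows "real T / (2 * real N) \<le> real (card {t. t < T \<and> t mod N = i})"
proof -
  have "(\<lambda>k. i + N * k) ` {..<T div N} \<subseteq> {t. t < T \<and> t mod N = i}"
  proof clarsimp
    fix k assume "k < T div N"
    then have "N * Suc k \<le> N * (T div N)" by (intro mult_le_mono) auto
    also have "\<dots> \<le> T" by simp
    finally show "i + N * k < T \<and> i mod N = i" using assms by simp
  qed
  then have "card ((\<lambda>k. i + N * k) ` {..<T div N}) \<le> card {t. t < T \<and> t mod N = i}"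
    by (intro card_mono) auto
  moreover have "inj_on (\<lambda>k. i + N * k) {..<T div N}"
    using assms by (auto simp: inj_on_def)
  ultimately have le: "T div N \<le> card {t. t < T \<and> t mod N = i}"
    by (simp add: card_image)
  have "T = N * (T div N) + T mod N" by simp
  moreover have "T mod N < N" "1 \<le> T div N"
    using assms by (auto simp: div_greater_zero_iff Suc_le_eq)
  moreover from this have "N * 1 \<le> N * (T div N)" by (intro mult_le_mono) auto
  \<comment> \<open>As T mod N < N <= N * (T div N), rounding T / N down loses at most a factor
    2.\<close>
  ultimately have "T \<le> 2 * (N * (T div N))" by linarith
  then have "real T \<le> real (2 * (N * (T div N)))" by (simp only: of_nat_le_iff)
  then have "real T / (2 * real N) \<le> real (T div N)"
    using assms by (simp add: field_simps)
  with le show ?thesis by linarith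
qed

text \<open>Distinct scales give distinct contexts, and staying in [1/2, 1] keeps the regret of each
  context within a factor 2 of that at scale 1, for every \<open>N\<close>.\<close>

definition scale :: "nat \<Rightarrow> real" where
  "scale i = 1 / 2 + 1 / (2 * real (Suc i))"

lemma scale_bounds: "1 / 2 \<le> scale i" "0 < scale i" "scale i \<le> 1"
proof -
  have "1 / (2 * real (Suc i)) \<le> 1 / 2" "0 < 1 / (2 * real (Suc i))"
    by (simp_all add: field_simps)
  then show "1 / 2 \<le> scale i" "0 < scale i" "scale i \<le> 1"
    by (simp_all only: scale_def)
qed

lemma inj_scale: "inj scale"
  by (rule injI) (simp add: scale_def)

lemma two_step_scale_eq_iff:
  "M \<ge> 2 \<Longrightarrow> two_step_valuation M (scale i) = two_step_valuation M (scale j) \<longleftrightarrow> i = j"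
  by (metis hd_two_step_valuation inj_scale injD)

text \<open>The competing bids are random because a fixed sequence admits an algorithm without
  regret, namely one that plays the best policy for it. A single law \<open>D\<close> is hard for
  all algorithms.\<close>

theorem mainTheorem19:
  "\<exists>c::real. c > 0 \<and>
    (\<forall>M\<ge>2. \<forall>K\<ge>M. \<forall>N\<ge>1.
      \<exists>V. V \<subseteq> valuations M \<and> finite V \<and> card V = N \<and>
        (\<forall>T\<ge>N. \<exists>(v :: nat \<Rightarrow> valuation) (D :: (nat \<Rightarrow> competing) pmf).
          (\<forall>t<T. v t \<in> V) \<and>
          (\<forall>\<beta>\<in>set_pmf D. \<forall>t<T. \<beta> t \<in> competing_bids K) \<and>
          (\<forall>A. learning_algorithm M V A \<longrightarrow>
            measure_pmf.expectation D (\<lambda>\<beta>. regret_adv M K T V v A \<beta>)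
              \<ge> c * real M * sqrt (real (card V) * real T))))"
proof (intro exI[of _ "1 / 64"] conjI allI impI)
  show "(0::real) < 1 / 64" by simp
next
  fix M K N :: nat
  assume M: "2 \<le> M" "M \<le> K" and N: "1 \<le> N"
  define val where "val i = two_step_valuation M (scale i)" for i
  define V where "V = val ` {..<N}"
  have inj: "val i = val j \<longleftrightarrow> i = j" for i j
    using M by (simp add: val_def two_step_scale_eq_iff)
  have hd_val: "hd (val i) = scale i" for i
    using M by (simp add: val_def hd_two_step_valuation)
  have card: "card V = N"
    unfolding V_def by (subst card_image) (auto simp: inj_on_def inj)
  have step: "0 < hd u \<and> u = two_step_valuation M (hd u)" if "u \<in> V" for u
    using that scale_bounds(2) hd_val by (auto simp: V_def) (simp add: val_def)
  show "\<exists>V. V \<subseteq> valuations M \<and> finite V \<and> card V = N \<and>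
        (\<forall>T\<ge>N. \<exists>(v :: nat \<Rightarrow> valuation) (D :: (nat \<Rightarrow> competing) pmf).
          (\<forall>t<T. v t \<in> V) \<and>
          (\<forall>\<beta>\<in>set_pmf D. \<forall>t<T. \<beta> t \<in> competing_bids K) \<and>
          (\<forall>A. learning_algorithm M V A \<longrightarrow>
            measure_pmf.expectation D (\<lambda>\<beta>. regret_adv M K T V v A \<beta>)
              \<ge> 1 / 64 * real M * sqrt (real (card V) * real T)))"
  proof (intro exI[of _ V] conjI allI impI)
    show "V \<subseteq> valuations M"
      using M scale_bounds by (auto simp: V_def val_def less_imp_le intro!: two_step_valuation_in_valuations)
    show finV: "finite V" by (simp add: V_def)
    show "card V = N" by (fact card)
    fix T assume T: "N \<le> T"
    \<comment> \<open>Cycling through the contexts gives each of them at least T / (2 N)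
      rounds.\<close>
    define v where "v t = val (t mod N)" for t
    define D where "D = map_pmf (\<lambda>x t. coin_bids K (v t) (x t)) (coins T)"
    have v: "v t \<in> V" for t using N by (auto simp: v_def V_def)
    show "\<exists>(v :: nat \<Rightarrow> valuation) (D :: (nat \<Rightarrow> competing) pmf).
          (\<forall>t<T. v t \<in> V) \<and>
          (\<forall>\<beta>\<in>set_pmf D. \<forall>t<T. \<beta> t \<in> competing_bids K) \<and>
          (\<forall>A. learning_algorithm M V A \<longrightarrow>
            measure_pmf.expectation D (\<lambda>\<beta>. regret_adv M K T V v A \<beta>)
              \<ge> 1 / 64 * real M * sqrt (real (card V) * real T))"
    proof (intro exI[of _ v] exI[of _ D] conjI allI impI ballI)
      show "v t \<in> V" for t by (fact v)
      fix \<beta> t assume "\<beta> \<in> set_pmf D"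
      then obtain b where "\<beta> t = coin_bids K (v t) b" by (auto simp: D_def)
      then show "\<beta> t \<in> competing_bids K"
        using scale_bounds[of "t mod N"]
        by (auto simp: competing_bids_def coin_bids_def v_def hd_val)
    next
      fix A assume A: "learning_algorithm M V A"
      let ?r = "sqrt (real T / (2 * real N))"
      \<comment> \<open>The extreme case is M = 3.\<close>
      have h: "real M / 3 \<le> real (M div 2)"
      proof -
        have "M \<le> 3 * (M div 2)" using M by linarith
        then show ?thesis by linarith
      qed
      have sq2: "sqrt 2 \<le> 2" by (rule real_le_lsqrt) auto
      have "real N * ?r = sqrt (real N * real T) / sqrt 2"
        using N by (simp add: real_sqrt_divide real_sqrt_mult field_simps)
      moreover have "sqrt (real N * real T) / sqrt 2 \<ge> sqrt (real N * real T) / 2"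
        using sq2 by (intro divide_left_mono) auto
      ultimately have r: "sqrt (real N * real T) / 2 \<le> real N * ?r" by simp
      \<comment> \<open>The factors are 1/2 from the scale, 1/3 from \<open>M div 2\<close>, 1/2
        from s h / 2 and 3/8 from the walk, together 1/32. The last 1/2 comes from \<open>r\<close>,
        which bounds \<open>sqrt 2\<close> by 2.\<close>
      have "1 / 64 * real M * sqrt (real (card V) * real T)
          = real M / 32 * (sqrt (real N * real T) / 2)"
        by (simp add: card)
      also have "\<dots> \<le> real M / 32 * (real N * ?r)"
        using r by (intro mult_left_mono) auto
      also have "\<dots> = (\<Sum>u\<in>V. 1 / 2 * (real M / 3) / 2 * (3 / 8 * ?r))"
        by (simp add: card)
      also have "\<dots> \<le> (\<Sum>u\<in>V. hd u * real (M div 2) / 2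
          * (3 / 8 * sqrt (real (card {t. t < T \<and> v t = u}))))"
      proof (rule sum_mono)
        fix u assume "u \<in> V"
        then obtain i where i: "i < N" "u = val i" by (auto simp: V_def)
        have "?r \<le> sqrt (real (card {t. t < T \<and> v t = u}))"
          using card_residue_class_ge[OF i(1) T] by (simp add: i(2) v_def inj)
        moreover have "1 / 2 * (real M / 3) \<le> hd u * real (M div 2)"
          using h scale_bounds[of i] by (intro mult_mono) (auto simp: i(2) hd_val)
        ultimately show "1 / 2 * (real M / 3) / 2 * (3 / 8 * ?r) \<le> hd u * real (M div 2) / 2
            * (3 / 8 * sqrt (real (card {t. t < T \<and> v t = u})))"
          using scale_bounds(2)[of i] by (intro mult_mono) (auto simp: i(2) hd_val)
      qed
      also have "\<dots> \<le> measure_pmf.expectation D (\<lambda>\<beta>. regret_adv M K T V v A \<beta>)"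
        using expected_regret_ge[OF M finV v step A] by (simp add: D_def)
      finally show "1 / 64 * real M * sqrt (real (card V) * real T)
          \<le> measure_pmf.expectation D (\<lambda>\<beta>. regret_adv M K T V v A \<beta>)" .
    qed
  qed
qed

end
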